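(* Let $n\ge2$, let $\theta<\omega^\omega$ be a nonzero limit ordinal, and let $\alpha$ be a nonzero limit ordinal. Then $\mathfrak T_\alpha^n$ is elementarily equivalent to $\mathfrak T_\theta^n$ if and only if $\alpha=\theta$.
   Context: For a nonzero limit ordinal $\alpha$, $\mathfrak T_\alpha^n=(n^{<\alpha},\subseteq,S_0,\dots,S_{n-1})$, where $n^{<\alpha}$ is the set of all functions $s:\beta\to n=\{0,\dots,n-1\}$ with $\beta<\alpha$, $\subseteq$ is the initial-segment (inclusion) order, and $S_i(s)$ is $s$ extended by one further entry $i$. *)

theory Defs
  imports Main "HOL-Library.Multiset_Order"
begin

section \<open>First-order logic with equality\<close>

datatype 'f fo_term = Var nat | Fn 'f "'f fo_term list"

datatype ('f, 'p) fo_form =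
    Eq "'f fo_term" "'f fo_term"
  | Rel 'p "'f fo_term list"
  | Neg "('f, 'p) fo_form"
  | Conj "('f, 'p) fo_form" "('f, 'p) fo_form"
  | Ex nat "('f, 'p) fo_form"

text \<open>A signature assigns arities; symbols mapped to \<open>None\<close> do not belong to it.\<close>

record ('f, 'p) fo_sig =
  fn_arity :: "'f \<Rightarrow> nat option"
  rel_arity :: "'p \<Rightarrow> nat option"

fun wf_term :: "('f, 'p) fo_sig \<Rightarrow> 'f fo_term \<Rightarrow> bool" where
  "wf_term L (Var x) \<longleftrightarrow> True"
| "wf_term L (Fn f ts) \<longleftrightarrow> fn_arity L f = Some (length ts) \<and> (\<forall>t\<in>set ts. wf_term L t)"

fun wf_form :: "('f, 'p) fo_sig \<Rightarrow> ('f, 'p) fo_form \<Rightarrow> bool" where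
  "wf_form L (Eq t u) \<longleftrightarrow> wf_term L t \<and> wf_term L u"
| "wf_form L (Rel p ts) \<longleftrightarrow> rel_arity L p = Some (length ts) \<and> (\<forall>t\<in>set ts. wf_term L t)"
| "wf_form L (Neg \<phi>) \<longleftrightarrow> wf_form L \<phi>"
| "wf_form L (Conj \<phi> \<psi>) \<longleftrightarrow> wf_form L \<phi> \<and> wf_form L \<psi>"
| "wf_form L (Ex x \<phi>) \<longleftrightarrow> wf_form L \<phi>"

fun vars_term :: "'f fo_term \<Rightarrow> nat set" where
  "vars_term (Var x) = {x}"
| "vars_term (Fn f ts) = (\<Union>t\<in>set ts. vars_term t)"

fun free_vars :: "('f, 'p) fo_form \<Rightarrow> nat set" where
  "free_vars (Eq t u) = vars_term t \<union> vars_term u"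
| "free_vars (Rel p ts) = (\<Union>t\<in>set ts. vars_term t)"
| "free_vars (Neg \<phi>) = free_vars \<phi>"
| "free_vars (Conj \<phi> \<psi>) = free_vars \<phi> \<union> free_vars \<psi>"
| "free_vars (Ex x \<phi>) = free_vars \<phi> - {x}"

definition sentence :: "('f, 'p) fo_sig \<Rightarrow> ('f, 'p) fo_form \<Rightarrow> bool" where
  "sentence L \<phi> \<longleftrightarrow> wf_form L \<phi> \<and> free_vars \<phi> = {}"

record ('a, 'f, 'p) fo_struct =
  universe :: "'a set"
  fn_int :: "'f \<Rightarrow> 'a list \<Rightarrow> 'a"
  rel_int :: "'p \<Rightarrow> 'a list \<Rightarrow> bool"

definition is_struct :: "('f, 'p) fo_sig \<Rightarrow> ('a, 'f, 'p) fo_struct \<Rightarrow> bool" where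
  "is_struct L M \<longleftrightarrow> universe M \<noteq> {} \<and>
     (\<forall>f xs. fn_arity L f = Some (length xs) \<and> set xs \<subseteq> universe M \<longrightarrow> fn_int M f xs \<in> universe M)"

fun term_val :: "('a, 'f, 'p) fo_struct \<Rightarrow> (nat \<Rightarrow> 'a) \<Rightarrow> 'f fo_term \<Rightarrow> 'a" where
  "term_val M e (Var x) = e x"
| "term_val M e (Fn f ts) = fn_int M f (map (term_val M e) ts)"

fun sat :: "('a, 'f, 'p) fo_struct \<Rightarrow> (nat \<Rightarrow> 'a) \<Rightarrow> ('f, 'p) fo_form \<Rightarrow> bool" where
  "sat M e (Eq t u) \<longleftrightarrow> term_val M e t = term_val M e u"
| "sat M e (Rel p ts) \<longleftrightarrow> rel_int M p (map (term_val M e) ts)"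
| "sat M e (Neg \<phi>) \<longleftrightarrow> \<not> sat M e \<phi>"
| "sat M e (Conj \<phi> \<psi>) \<longleftrightarrow> sat M e \<phi> \<and> sat M e \<psi>"
| "sat M e (Ex x \<phi>) \<longleftrightarrow> (\<exists>a\<in>universe M. sat M (e(x := a)) \<phi>)"

definition models :: "('a, 'f, 'p) fo_struct \<Rightarrow> ('f, 'p) fo_form \<Rightarrow> bool" where
  "models M \<phi> \<longleftrightarrow> (\<forall>e. range e \<subseteq> universe M \<longrightarrow> sat M e \<phi>)"

definition elem_equiv ::
    "('f, 'p) fo_sig \<Rightarrow> ('a, 'f, 'p) fo_struct \<Rightarrow> ('b, 'f, 'p) fo_struct \<Rightarrow> bool" where
  "elem_equiv L M N \<longleftrightarrow> (\<forall>\<phi>. sentence L \<phi> \<longrightarrow> (models M \<phi> \<longleftrightarrow> models N \<phi>))"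


section \<open>Ordinals\<close>

text \<open>Ordinals are represented by well-orders in the sense of \<^const>\<open>Well_order\<close>, taken up to
  \<^const>\<open>ordIso\<close> and compared by \<^const>\<open>ordLess\<close>. The ordinals below the order type of \<open>r\<close> are
  then the initial segments \<open>underS r a\<close> with \<open>a \<in> Field r\<close>, each of them arising from
  exactly one \<open>a\<close>.\<close>

definition nonzero_limit :: "'a rel \<Rightarrow> bool" where
  "nonzero_limit r \<longleftrightarrow> Well_order r \<and> Field r \<noteq> {} \<and>
     (\<forall>a\<in>Field r. \<exists>b\<in>Field r. a \<noteq> b \<and> (a, b) \<in> r)"

text \<open>The ordinal power \<open>\<omega>\<^sup>\<omega>\<close>: finitely supported functions from \<open>\<omega>\<close> to \<open>\<omega>\<close>, compared at the
  largest argument at which they differ; \<open>f\<close> stands for the Cantor normal form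
  \<open>\<dots> + \<omega>\<^sup>2 * f 2 + \<omega> * f 1 + f 0\<close>.\<close>

definition omega_pow_omega :: "(nat \<Rightarrow> nat) rel" where
  "omega_pow_omega = {(f, g). finite {k. f k \<noteq> 0} \<and> finite {k. g k \<noteq> 0} \<and>
     (f = g \<or> (\<exists>k. f k < g k \<and> (\<forall>j>k. f j = g j)))}"

lemma Field_omega_pow_omega: "Field omega_pow_omega = {f. finite {k. f k \<noteq> 0}}"
  unfolding omega_pow_omega_def Field_def by auto

lemma omega_pow_omega_iff_multiset:
  assumes "finite {k. f k \<noteq> 0}" "finite {k. g k \<noteq> 0}"
  shows "(f, g) \<in> omega_pow_omega \<longleftrightarrow> Abs_multiset f \<le> Abs_multiset g"
proof -
  have cnt: "count (Abs_multiset f) = f" "count (Abs_multiset g) = g"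
    using assms by (simp_all add: Abs_multiset_inverse)
  have eq: "Abs_multiset f = Abs_multiset g \<longleftrightarrow> f = g"
    using cnt by metis
  have "(\<exists>k. f k < g k \<and> (\<forall>j>k. f j = g j)) \<longleftrightarrow>
      f \<noteq> g \<and> (\<forall>y. g y < f y \<longrightarrow> (\<exists>x>y. f x < g x))" (is "?L \<longleftrightarrow> ?R")
  proof
    assume ?L
    then obtain k where "f k < g k" "\<forall>j>k. f j = g j" by blast
    then show ?R by (metis linorder_neqE_nat not_less_iff_gr_or_eq)
  next
    assume R: ?R
    define D where "D = {k. f k \<noteq> g k}"
    have "D \<subseteq> {k. f k \<noteq> 0} \<union> {k. g k \<noteq> 0}" by (auto simp: D_def)
    then have "finite D" using assms by (meson finite_UnI finite_subset)
    moreover have "D \<noteq> {}" using R by (auto simp: D_def)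
    ultimately have M: "Max D \<in> D" by (rule Max_in)
    have "j \<le> Max D" if "j \<in> D" for j using \<open>finite D\<close> that by (rule Max_ge)
    then have above: "\<forall>j>Max D. f j = g j" using D_def leD by blast
    have "f (Max D) < g (Max D)"
    proof (rule ccontr)
      assume "\<not> ?thesis"
      then have "g (Max D) < f (Max D)" using M(1) by (auto simp: D_def)
      then obtain x where "x > Max D" "f x < g x" using R by blast
      then show False using above by auto
    qed
    then show ?L using above by blast
  qed
  also have "?R \<longleftrightarrow> Abs_multiset f < Abs_multiset g"
    by (simp only: less_multiset\<^sub>H\<^sub>O cnt eq)
  finally have less: "?L \<longleftrightarrow> Abs_multiset f < Abs_multiset g" .
  have "(f, g) \<in> omega_pow_omega \<longleftrightarrow> f = g \<or> ?L"
    using assms by (simp only: omega_pow_omega_def mem_Collect_eq case_prod_conv simp_thms)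
  then show ?thesis unfolding less eq[symmetric] le_less by blast
qed

lemma Well_order_omega_pow_omega: "Well_order omega_pow_omega"
proof -
  let ?r = omega_pow_omega and ?F = "{f :: nat \<Rightarrow> nat. finite {k. f k \<noteq> 0}}"
  have sub: "f \<in> ?F" "g \<in> ?F" if "(f, g) \<in> ?r" for f g
    using that by (auto simp: omega_pow_omega_def)
  have iff: "(f, g) \<in> ?r \<longleftrightarrow> Abs_multiset f \<le> Abs_multiset g" if "f \<in> ?F" "g \<in> ?F" for f g
    using omega_pow_omega_iff_multiset that by simp
  have inj: "f = g" if "f \<in> ?F" "g \<in> ?F" "Abs_multiset f = Abs_multiset g" for f g
  proof -
    have "count (Abs_multiset f) = f" "count (Abs_multiset g) = g"
      using that(1,2) by (simp_all add: Abs_multiset_inverse)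
    then show ?thesis using that(3) by metis
  qed
  have "refl_on ?F ?r" by (auto simp: refl_on_def omega_pow_omega_def)
  moreover have "?r \<subseteq> ?F \<times> ?F" using sub by auto
  moreover have "trans ?r" using iff sub by (meson order.trans transI)
  moreover have "antisym ?r" using iff sub inj by (meson antisymI order.antisym)
  moreover have "total_on ?F ?r" using iff by (meson linear total_onI)
  moreover have "wf (?r - Id)"
  proof (rule wf_subset)
    show "wf (inv_image {(M :: nat multiset, N). M < N} Abs_multiset)"
      by (intro wf_inv_image wf_less_multiset)
    show "?r - Id \<subseteq> inv_image {(M :: nat multiset, N). M < N} Abs_multiset"
    proof (rule subrelI)
      fix f g assume fg: "(f, g) \<in> ?r - Id"
      then have "f \<in> ?F" "g \<in> ?F" "f \<noteq> g" using sub by blast+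
      moreover from this have "Abs_multiset f \<le> Abs_multiset g" using iff fg by blast
      ultimately have "Abs_multiset f < Abs_multiset g" using inj le_less by blast
      then show "(f, g) \<in> inv_image {(M :: nat multiset, N). M < N} Abs_multiset" by simp
    qed
  qed
  ultimately show ?thesis
    by (simp add: Field_omega_pow_omega well_order_on_def linear_order_on_def
        partial_order_on_def preorder_on_def)
qed


section \<open>The trees\<close>

text \<open>One binary relation symbol \<open>()\<close> for inclusion and unary function symbols
  \<open>0, \<dots>, n - 1\<close> for the successors.\<close>

definition tree_sig :: "nat \<Rightarrow> (nat, unit) fo_sig" where
  "tree_sig n = \<lparr>fn_arity = (\<lambda>i. if i < n then Some 1 else None), rel_arity = (\<lambda>_. Some 2)\<rparr>"

text \<open>A function with domain \<open>\<beta> < \<alpha>\<close> is a partial function on \<^term>\<open>Field r\<close> with domain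
  \<^term>\<open>underS r a\<close>, where \<open>r\<close> represents \<open>\<alpha>\<close> and \<open>a\<close> corresponds to \<open>\<beta>\<close>.\<close>

definition tree_nodes :: "nat \<Rightarrow> 'a rel \<Rightarrow> ('a \<rightharpoonup> nat) set" where
  "tree_nodes n r = {s. (\<exists>a\<in>Field r. dom s = underS r a) \<and> ran s \<subseteq> {..<n}}"

definition tree_length :: "'a rel \<Rightarrow> ('a \<rightharpoonup> nat) \<Rightarrow> 'a" where
  "tree_length r s = (THE a. a \<in> Field r \<and> dom s = underS r a)"

text \<open>The entry \<open>i\<close> is appended at the first position outside the domain of \<open>s\<close>.\<close>

definition tree_succ :: "'a rel \<Rightarrow> nat \<Rightarrow> ('a \<rightharpoonup> nat) \<Rightarrow> ('a \<rightharpoonup> nat)" where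
  "tree_succ r i s = s(tree_length r s \<mapsto> i)"

definition tree :: "nat \<Rightarrow> 'a rel \<Rightarrow> ('a \<rightharpoonup> nat, nat, unit) fo_struct" where
  "tree n r = \<lparr>universe = tree_nodes n r,
     fn_int = (\<lambda>i xs. tree_succ r i (xs ! 0)),
     rel_int = (\<lambda>_ xs. xs ! 0 \<subseteq>\<^sub>m xs ! 1)\<rparr>"

lemma underS_inj:
  assumes "Well_order r" "a \<in> Field r" "b \<in> Field r" "underS r a = underS r b"
  shows "a = b"
proof (rule ccontr)
  assume "a \<noteq> b"
  moreover from this have "(a, b) \<in> r \<or> (b, a) \<in> r"
    using assms(1-3) by (auto simp: well_order_on_def linear_order_on_def total_on_def)
  ultimately have "a \<in> underS r b \<or> b \<in> underS r a" by (auto simp: underS_def)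
  then show False using assms(4) by (auto simp: underS_def)
qed

lemma tree_length_eq:
  assumes "Well_order r" "a \<in> Field r" "dom s = underS r a"
  shows "tree_length r s = a"
  unfolding tree_length_def 
proof (rule the_equality)
  show "a \<in> Field r \<and> dom s = underS r a" using assms by simp
next
  fix b assume "b \<in> Field r \<and> dom s = underS r b"
  then show "b = a" using assms underS_inj[of r b a] by simp
qed

lemma is_struct_tree:
  assumes "nonzero_limit r"
  shows "is_struct (tree_sig n) (tree n r)"
proof -
  have wo: "Well_order r" and ne: "Field r \<noteq> {}"
    using assms by (auto simp: nonzero_limit_def)
  have W: "wo_rel r" using wo by (simp add: wo_rel_def)
  have anti: "\<And>x y. (x, y) \<in> r \<Longrightarrow> (y, x) \<in> r \<Longrightarrow> x = y"
    using wo_rel.ANTISYM[OF W] by (auto simp: antisym_def)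
  have trans: "\<And>x y z. (x, y) \<in> r \<Longrightarrow> (y, z) \<in> r \<Longrightarrow> (x, z) \<in> r"
    using wo_rel.TRANS[OF W] by (auto simp: trans_def)
  have "\<exists>s. s \<in> tree_nodes n r"
  proof -
    let ?m = "wo_rel.minim r (Field r)"
    have m: "?m \<in> Field r" using wo_rel.minim_in[OF W _ ne] by simp
    have "x \<notin> underS r ?m" for x
    proof
      assume x: "x \<in> underS r ?m"
      then have "x \<in> Field r" by (auto simp: underS_def Field_def)
      then have "(?m, x) \<in> r" using wo_rel.minim_least[OF W] by simp
      then show False using x anti by (auto simp: underS_def)
    qed
    then have "underS r ?m = {}" by auto
    then show ?thesis using m
      by (intro exI[of _ Map.empty]) (auto simp: tree_nodes_def)
  qed
  moreover have "tree_succ r i s \<in> tree_nodes n r" if si: "s \<in> tree_nodes n r" "i < n" for i s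
  proof -
    obtain a where a: "a \<in> Field r" "dom s = underS r a" "ran s \<subseteq> {..<n}"
      using si(1) by (auto simp: tree_nodes_def)
    have len: "tree_length r s = a" using tree_length_eq[OF wo a(1,2)] .
    have ne: "AboveS r {a} \<noteq> {}"
      using assms a(1) by (fastforce simp: nonzero_limit_def AboveS_def)
    have sub: "{a} \<subseteq> Field r" using a by simp
    let ?b = "wo_rel.suc r {a}"
    have b: "?b \<in> Field r" "a \<noteq> ?b" "(a, ?b) \<in> r"
      using wo_rel.suc_inField[OF W sub ne] wo_rel.suc_greater[OF W sub ne, of a] by auto
    have "underS r ?b = insert a (underS r a)"
    proof (intro equalityI subsetI)
      fix x assume x: "x \<in> underS r ?b"
      then have xF: "x \<in> Field r" by (auto simp: underS_def Field_def)
      show "x \<in> insert a (underS r a)"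
      proof (rule ccontr)
        assume "x \<notin> insert a (underS r a)"
        then have "(a, x) \<in> r" "x \<noteq> a"
          using xF a(1) wo_rel.TOTALS[OF W] by (auto simp: underS_def)
        then have "(?b, x) \<in> r"
          using wo_rel.suc_least_AboveS[OF W, of x "{a}"] xF by (auto simp: AboveS_def)
        then show False using x anti by (auto simp: underS_def)
      qed
    next
      fix x assume "x \<in> insert a (underS r a)"
      then show "x \<in> underS r ?b"
        using b anti[of x] trans[of x a] by (auto simp: underS_def)
    qed
    then have "dom (tree_succ r i s) = underS r ?b"
      using a(2) by (simp add: tree_succ_def len)
    moreover have "ran (tree_succ r i s) \<subseteq> {..<n}"
      using a(3) si(2) by (auto simp: tree_succ_def ran_def split: if_splits)
    ultimately show ?thesis using b(1) by (auto simp: tree_nodes_def)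
  qed
  moreover have "xs ! 0 \<in> A" if "length xs = 1" "set xs \<subseteq> A" for xs and A :: "('a \<rightharpoonup> nat) set"
    using that by (cases xs) auto
  ultimately show ?thesis
    unfolding is_struct_def tree_def tree_sig_def by (auto split: if_split_asm)
qed

end

theory Submission
  imports Defs
begin

text \<open>Below a node the inclusion order is a well-order of the type of its length, so it suffices to
  define every ordinal below \<open>\<omega>\<^sup>\<omega>\<close> by a first-order formula in the order relation. The ordinal
  \<open>u + \<omega>\<^sup>k\<^sup>+\<^sup>1\<close> is the least \<open>t > u\<close> such that \<open>v + \<omega>\<^sup>k < t\<close> whenever \<open>u \<le> v < t\<close>, and every
  ordinal below \<open>\<omega>\<^sup>\<omega>\<close> is a finite sum of powers \<open>\<omega>\<^sup>k\<close>. All quantifiers are bounded by the point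
  being defined, hence the formulas mean the same in a well-order, in its initial segments, and in
  the tree; and leastness makes the defined point unique. So elementarily equivalent trees realise
  the same sums as lengths, which for \<open>\<theta> < \<omega>\<^sup>\<omega>\<close> determines \<open>\<alpha>\<close>.\<close>

section \<open>Adding powers of omega in an order\<close>

text \<open>In a well-order, the least \<open>t\<close> such that \<open>above_pow r k u t\<close> is \<open>u + \<omega>\<^sup>k\<close>.\<close>

primrec above_pow :: "'a rel \<Rightarrow> nat \<Rightarrow> 'a \<Rightarrow> 'a \<Rightarrow> bool" where
  "above_pow r 0 u t \<longleftrightarrow> (u, t) \<in> r - Id"
| "above_pow r (Suc k) u t \<longleftrightarrow> (u, t) \<in> r - Id \<and>
     (\<forall>v. (u, v) \<in> r \<and> (v, t) \<in> r - Id \<longrightarrow>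
       (\<exists>w. (w, t) \<in> r - Id \<and> above_pow r k v w \<and> \<not> (\<exists>z. (z, w) \<in> r - Id \<and> above_pow r k v z)))"

definition add_pow :: "'a rel \<Rightarrow> nat \<Rightarrow> 'a \<Rightarrow> 'a \<Rightarrow> bool" where
  "add_pow r k u t \<longleftrightarrow> above_pow r k u t \<and> \<not> (\<exists>z. (z, t) \<in> r - Id \<and> above_pow r k u z)"

text \<open>The head of the list is the exponent of the rightmost summand.\<close>

primrec pow_sum :: "'a rel \<Rightarrow> nat list \<Rightarrow> 'a \<Rightarrow> bool" where
  "pow_sum r [] t \<longleftrightarrow> t \<in> Field r \<and> (\<forall>u. (u, t) \<in> r \<longrightarrow> u = t)"
| "pow_sum r (k # ks) t \<longleftrightarrow> (\<exists>u. pow_sum r ks u \<and> add_pow r k u t)"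

text \<open>The recursion has to spell out leastness, since \<open>add_pow\<close> exists only once
  \<open>above_pow\<close> is complete; this folds it back.\<close>

lemma above_pow_Suc:
  "above_pow r (Suc k) u t \<longleftrightarrow> (u, t) \<in> r - Id \<and>
     (\<forall>v. (u, v) \<in> r \<and> (v, t) \<in> r - Id \<longrightarrow> (\<exists>w. (w, t) \<in> r - Id \<and> add_pow r k v w))"
  by (simp add: add_pow_def)

declare above_pow.simps(2) [simp del]

text \<open>Bounded existentials in place of universals: the shape that fits the first-order formula
  and the transfer of quantifiers between orders.\<close>

lemma above_pow_Suc_ex:
  "above_pow r (Suc k) u t \<longleftrightarrow> (u, t) \<in> r - Id \<and>
     \<not> (\<exists>v. (v, t) \<in> r - Id \<and> (u, v) \<in> r \<and> \<not> (\<exists>w. (w, t) \<in> r - Id \<and> add_pow r k v w))"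
proof -
  have *: "(\<forall>v. B v \<and> C v \<longrightarrow> D v) \<longleftrightarrow> \<not> (\<exists>v. C v \<and> B v \<and> \<not> D v)" for B C D :: "'a \<Rightarrow> bool"
    by blast
  show ?thesis unfolding above_pow_Suc * ..
qed

lemma above_pow_less: "above_pow r k u t \<Longrightarrow> (u, t) \<in> r - Id"
  by (cases k; hypsubst; unfold above_pow.simps(1) above_pow_Suc; blast)

lemma add_pow_less: "add_pow r k u t \<Longrightarrow> (u, t) \<in> r - Id"
  unfolding add_pow_def by (elim conjE above_pow_less)

lemma pow_sum_Field: "pow_sum r ks t \<Longrightarrow> t \<in> Field r"
proof (cases ks)
  case (Cons k ks')
  assume "pow_sum r ks t"
  then obtain u where "add_pow r k u t" unfolding Cons pow_sum.simps by blast
  then show ?thesis by (blast dest: add_pow_less intro: FieldI2)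
qed simp

text \<open>Two distinct least points would be comparable, and the smaller would refute the
  leastness of the larger.\<close>

lemma add_pow_unique:
  assumes "Well_order r" "add_pow r k u s" "add_pow r k u t"
  shows "s = t"
proof (rule ccontr)
  assume "s \<noteq> t"
  moreover have "s \<in> Field r" "t \<in> Field r"
    using assms(2,3) by (blast dest: add_pow_less intro: FieldI2)+
  ultimately have "(s, t) \<in> r - Id \<or> (t, s) \<in> r - Id"
    using assms(1) by (auto simp: well_order_on_def linear_order_on_def total_on_def)
  then show False using assms(2,3) unfolding add_pow_def by blast
qed

lemma pow_sum_unique:
  assumes "Well_order r" "pow_sum r ks s" "pow_sum r ks t"
  shows "s = t"
  using assms(2,3)
proof (induction ks arbitrary: s t)
  case Nil
  then have "(s, t) \<in> r \<or> (t, s) \<in> r"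
    using wo_rel.TOTALS[of r] assms(1) by (auto simp: wo_rel_def)
  then show ?case using Nil by auto
next
  case (Cons k ks)
  then show ?case using add_pow_unique[OF assms(1)] by (metis pow_sum.simps(2))
qed

section \<open>Absoluteness\<close>

text \<open>For every \<open>z\<close> in \<open>Field P\<close> such a map restricts to an order
  isomorphism from the points below \<open>z\<close> onto the points below \<open>h z\<close>;
  globally it need not be injective. The instances are embeddings of well-orders and the length map
  on the tree.\<close>

locale down_morphism =
  fixes P :: "'a rel" and Q :: "'b rel" and h :: "'a \<Rightarrow> 'b"
  assumes Partial_order_P: "Partial_order P"
    and antisym_Q: "antisym Q"
    and Field: "x \<in> Field P \<Longrightarrow> h x \<in> Field Q"
    and mono: "(x, y) \<in> P \<Longrightarrow> (h x, h y) \<in> Q"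
    and lift: "y \<in> Field P \<Longrightarrow> (b, h y) \<in> Q \<Longrightarrow> \<exists>x. (x, y) \<in> P \<and> h x = b"
    and reflect: "(x, z) \<in> P \<Longrightarrow> (y, z) \<in> P \<Longrightarrow> (h x, h y) \<in> Q \<Longrightarrow> (x, y) \<in> P"
begin

lemma trans_P: "(x, y) \<in> P \<Longrightarrow> (y, z) \<in> P \<Longrightarrow> (x, z) \<in> P"
  using Partial_order_P
  by (auto simp: partial_order_on_def preorder_on_def elim: transE)

lemma less_iff:
  assumes "(x, z) \<in> P" "(y, z) \<in> P"
  shows "(h x, h y) \<in> Q - Id \<longleftrightarrow> (x, y) \<in> P - Id"
proof -
  have "x = y" if "(x, y) \<in> P" "h x = h y"
  proof -
    have "(h y, h x) \<in> Q" using mono[OF that(1)] that(2) by simp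
    then have "(y, x) \<in> P" using reflect assms by blast
    then show ?thesis using that(1) Partial_order_P
      by (auto simp: partial_order_on_def elim: antisymD)
  qed
  then show ?thesis using mono[of x y] reflect[OF assms] by auto
qed

text \<open>Asking only for a common bound \<open>z\<close>, instead of \<open>u\<close> below
  \<open>t\<close>, keeps the induction hypothesis applicable to any two points below
  \<open>z\<close>.\<close>

lemma above_pow_iff:
  "(u, z) \<in> P \<Longrightarrow> (t, z) \<in> P \<Longrightarrow> above_pow Q k (h u) (h t) \<longleftrightarrow> above_pow P k u t"
proof (induction k arbitrary: u t z)
  case 0
  then show ?case using less_iff by simp
next
  case (Suc k)
  \<comment> \<open>Every point of \<open>Q\<close> below \<open>h y\<close> has a preimage below
    \<open>y\<close> by \<open>lift\<close>, so bounded quantifiers move from \<open>Q\<close> to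
    \<open>P\<close>.\<close>
  have ex_below: "(\<exists>b. (b, h y) \<in> Q - Id \<and> R b) \<longleftrightarrow> (\<exists>x. (x, y) \<in> P - Id \<and> R (h x))"
    if "(y, z) \<in> P" for y R
  proof
    assume "\<exists>b. (b, h y) \<in> Q - Id \<and> R b"
    then obtain b where b: "(b, h y) \<in> Q - Id" "R b" by blast
    moreover have "y \<in> Field P" using that by (auto simp: Field_def)
    ultimately obtain x where x: "(x, y) \<in> P" "h x = b" using lift by blast
    then have "(x, y) \<in> P - Id" using b(1) by auto
    then show "\<exists>x. (x, y) \<in> P - Id \<and> R (h x)" using b(2) x(2) by blast
  next
    assume "\<exists>x. (x, y) \<in> P - Id \<and> R (h x)"
    then obtain x where x: "(x, y) \<in> P - Id" "R (h x)" by blast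
    then have "(h x, h y) \<in> Q - Id" using less_iff[of x z y] that trans_P by blast
    then show "\<exists>b. (b, h y) \<in> Q - Id \<and> R b" using x(2) by blast
  qed
  have below: "(x, z) \<in> P" if "(x, y) \<in> P - Id" "(y, z) \<in> P" for x y
    using that trans_P by blast
  have add: "add_pow Q k (h v) (h w) \<longleftrightarrow> add_pow P k v w" if vw: "(v, z) \<in> P" "(w, z) \<in> P" for v w
  proof -
    have "above_pow Q k (h v) (h x) \<longleftrightarrow> above_pow P k v x" if "(x, w) \<in> P - Id" for x
      using Suc.IH[OF vw(1) below[OF that vw(2)]] .
    then show ?thesis
      unfolding add_pow_def ex_below[OF vw(2)] Suc.IH[OF vw] by blast
  qed
  have ex_add: "(\<exists>b. (b, h t) \<in> Q - Id \<and> add_pow Q k (h v) b) \<longleftrightarrow>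
      (\<exists>w. (w, t) \<in> P - Id \<and> add_pow P k v w)" if "(v, t) \<in> P - Id" for v
    unfolding ex_below[OF Suc.prems(2)]
    using add[OF below[OF that Suc.prems(2)] below[OF _ Suc.prems(2)]] by blast
  have le: "(h u, h v) \<in> Q \<longleftrightarrow> (u, v) \<in> P" if "(v, t) \<in> P - Id" for v
    using mono reflect[OF Suc.prems(1) below[OF that Suc.prems(2)]] by blast
  have "(\<exists>b. (b, h t) \<in> Q - Id \<and> (h u, b) \<in> Q \<and> \<not> (\<exists>w. (w, h t) \<in> Q - Id \<and> add_pow Q k b w)) \<longleftrightarrow>
      (\<exists>v. (v, t) \<in> P - Id \<and> (u, v) \<in> P \<and> \<not> (\<exists>w. (w, t) \<in> P - Id \<and> add_pow P k v w))"
    unfolding ex_below[OF Suc.prems(2),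
        where R = "\<lambda>b. (h u, b) \<in> Q \<and> \<not> (\<exists>w. (w, h t) \<in> Q - Id \<and> add_pow Q k b w)"]
    by (intro iff_exI conj_cong refl) (simp_all only: le ex_add)
  then show ?case
    unfolding above_pow_Suc_ex less_iff[OF Suc.prems] by (rule arg_cong)
qed

lemma add_pow_iff:
  assumes "(u, t) \<in> P"
  shows "add_pow Q k (h u) (h t) \<longleftrightarrow> add_pow P k u t"
proof -
  have t: "t \<in> Field P" using assms by (auto simp: Field_def)
  have tt: "(t, t) \<in> P"
    using t Partial_order_P by (auto simp: partial_order_on_def preorder_on_def refl_on_def)
  have "(\<exists>b. (b, h t) \<in> Q - Id \<and> above_pow Q k (h u) b) \<longleftrightarrow>
      (\<exists>z. (z, t) \<in> P - Id \<and> above_pow P k u z)" (is "?L \<longleftrightarrow> ?R")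
  proof
    assume ?L
    then obtain b where b: "(b, h t) \<in> Q - Id" "above_pow Q k (h u) b" by blast
    then obtain z where z: "(z, t) \<in> P" "h z = b" using lift[OF t] by blast
    then show ?R using b above_pow_iff[OF assms z(1)] by auto
  next
    assume ?R
    then obtain z where z: "(z, t) \<in> P - Id" "above_pow P k u z" by blast
    then show ?L using above_pow_iff[OF assms, of z] less_iff[OF _ tt, of z] by blast
  qed
  then show ?thesis unfolding add_pow_def above_pow_iff[OF assms tt] by simp
qed

text \<open>Every partial sum lies below \<open>t\<close>, so \<open>lift\<close> finds its preimage
  there and the summands transfer one at a time.\<close>

lemma pow_sum_iff:
  "t \<in> Field P \<Longrightarrow> pow_sum Q ks (h t) \<longleftrightarrow> pow_sum P ks t"
proof (induction ks arbitrary: t)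
  case Nil
  have tt: "(t, t) \<in> P"
    using Nil Partial_order_P by (auto simp: partial_order_on_def preorder_on_def refl_on_def)
  have "(\<forall>b. (b, h t) \<in> Q \<longrightarrow> b = h t) \<longleftrightarrow> (\<forall>u. (u, t) \<in> P \<longrightarrow> u = t)"
    using lift[OF Nil] less_iff[OF _ tt] mono by blast
  then show ?case using Nil Field by simp
next
  case (Cons k ks)
  have below: "(u, t) \<in> P" "u \<in> Field P" if "add_pow P k u t" for u
    using that[THEN add_pow_less] by (auto simp: Field_def)
  show ?case
  proof
    assume "pow_sum Q (k # ks) (h t)"
    then obtain b where b: "pow_sum Q ks b" "add_pow Q k b (h t)" by auto
    obtain u where u: "(u, t) \<in> P" "h u = b"
      using lift[OF Cons.prems] add_pow_less[OF b(2)] by blast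
    have "pow_sum P ks u" "add_pow P k u t"
      using b Cons.IH[OF FieldI1[OF u(1)]] add_pow_iff[OF u(1)] unfolding u(2) by blast+
    then show "pow_sum P (k # ks) t" by auto
  next
    assume "pow_sum P (k # ks) t"
    then obtain u where u: "pow_sum P ks u" "add_pow P k u t" by auto
    then have "pow_sum Q ks (h u)" "add_pow Q k (h u) (h t)"
      using Cons.IH[OF below(2)[OF u(2)]] add_pow_iff[OF below(1)[OF u(2)]] by blast+
    then show "pow_sum Q (k # ks) (h t)" by auto
  qed
qed

end

text \<open>An embedding maps initial segments bijectively onto initial segments, which gives
  \<open>lift\<close>; totality and injectivity give \<open>reflect\<close>.\<close>

lemma embed_down_morphism:
  assumes "Well_order r" "Well_order r'" "embed r r' f"
  shows "down_morphism r r' f"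
proof
  show "Partial_order r" "antisym r'"
    using assms(1,2) by (auto simp: well_order_on_def linear_order_on_def partial_order_on_def)
  show "f x \<in> Field r'" if "x \<in> Field r" for x
    using assms that by (meson embed_in_Field)
  show mono: "(f x, f y) \<in> r'" if "(x, y) \<in> r" for x y
    using embed_compat[OF assms(3)] that by (auto simp: compat_def)
  show "\<exists>x. (x, y) \<in> r \<and> f x = b" if "y \<in> Field r" "(b, f y) \<in> r'" for y b
  proof -
    have "b \<in> f ` under r y"
      using assms(3) that by (simp add: embed_def bij_betw_def under_def)
    then show ?thesis by (auto simp: under_def)
  qed
  show "(x, y) \<in> r" if "(x, z) \<in> r" "(y, z) \<in> r" "(f x, f y) \<in> r'" for x y z
  proof (rule ccontr)
    assume n: "(x, y) \<notin> r"
    have F: "x \<in> Field r" "y \<in> Field r" using that by (auto simp: Field_def)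
    have xx: "(x, x) \<in> r" using assms(1) F by (auto simp: well_order_on_def
          linear_order_on_def partial_order_on_def preorder_on_def refl_on_def)
    then have ne: "x \<noteq> y" using n by auto
    then have yx: "(y, x) \<in> r" using assms(1) F n
      by (auto simp: well_order_on_def linear_order_on_def total_on_def)
    then have "f x = f y" using mono that(3) \<open>antisym r'\<close> by (meson antisymD)
    moreover have "inj_on f (Field r)" using assms embed_inj_on by blast
    ultimately show False using F ne by (auto dest: inj_onD)
  qed
qed

section \<open>The ordinal \<open>\<omega>\<^sup>\<omega>\<close>\<close>

text \<open>The normal form of \<open>f + omega^k\<close>: the new summand absorbs all terms of
  exponent below \<open>k\<close>.\<close>

definition cnf_add :: "(nat \<Rightarrow> nat) \<Rightarrow> nat \<Rightarrow> nat \<Rightarrow> nat" where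
  "cnf_add f k = (\<lambda>j. if j < k then 0 else if j = k then Suc (f k) else f j)"

abbreviation cnfs :: "(nat \<Rightarrow> nat) set" where
  "cnfs \<equiv> Field omega_pow_omega"

lemma less_omega_pow_omega:
  "(f, g) \<in> omega_pow_omega - Id \<longleftrightarrow> f \<in> cnfs \<and> g \<in> cnfs \<and> (\<exists>k. f k < g k \<and> (\<forall>j>k. f j = g j))"
  unfolding Field_omega_pow_omega by (auto simp: omega_pow_omega_def)

lemma omega_pow_omega_lessI:
  assumes "f \<in> cnfs" "g \<in> cnfs" "f k < g k" "\<And>j. j > k \<Longrightarrow> f j = g j"
  shows "(f, g) \<in> omega_pow_omega - Id"
  unfolding less_omega_pow_omega using assms by blast

lemma cnfs_fun_upd:
  assumes "f \<in> cnfs" shows "f(k := c) \<in> cnfs"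
proof -
  have "{j. (f(k := c)) j \<noteq> 0} \<subseteq> insert k {j. f j \<noteq> 0}" by auto
  then show ?thesis
    using assms finite_subset[of _ "insert k {j. f j \<noteq> 0}"] unfolding Field_omega_pow_omega by blast
qed

lemma omega_pow_omega_refl: "f \<in> cnfs \<Longrightarrow> (f, f) \<in> omega_pow_omega"
  unfolding Field_omega_pow_omega by (simp add: omega_pow_omega_def)

text \<open>Together the hypotheses make \<open>f\<close> pointwise at most \<open>g\<close>, so if
  the two differ, the largest difference favours \<open>g\<close>.\<close>

lemma omega_pow_omega_leI:
  assumes "f \<in> cnfs" "g \<in> cnfs" "\<forall>j>k. f j = g j" "f k \<le> g k" "\<forall>j<k. f j \<le> g j"
  shows "(f, g) \<in> omega_pow_omega"
proof (cases "f = g")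
  case True
  then show ?thesis using assms omega_pow_omega_refl by blast
next
  case False
  define D where "D = {j. f j < g j}"
  have le: "f j \<le> g j" for j using assms(3-5) by (metis linorder_neqE_nat order_refl)
  have "D \<subseteq> {..k}" using assms(3) by (auto simp: D_def) (metis not_le_imp_less less_irrefl)
  then have fin: "finite D" using finite_subset by blast
  moreover have "D \<noteq> {}" using False le by (auto simp: D_def fun_eq_iff) (metis le_neq_implies_less)
  ultimately have "f (Max D) < g (Max D)" using Max_in by (auto simp: D_def)
  moreover have "f j = g j" if "j > Max D" for j
    using that le[of j] Max_ge[OF fin, of j] unfolding D_def
    by (metis le_neq_implies_less leD mem_Collect_eq)
  ultimately show ?thesis using assms(1,2) less_omega_pow_omega by blast
qed

lemma omega_pow_omega_not_le:
  assumes "(g, f) \<in> omega_pow_omega - Id" shows "(f, g) \<notin> omega_pow_omega - Id"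
  using assms Well_order_omega_pow_omega
  by (auto simp: well_order_on_def linear_order_on_def partial_order_on_def elim: antisymD)

section \<open>Adding one power of omega to a normal form\<close>

lemma cnf_add_Field:
  assumes "f \<in> cnfs" shows "cnf_add f k \<in> cnfs"
proof -
  have "{j. cnf_add f k j \<noteq> 0} \<subseteq> insert k {j. f j \<noteq> 0}" by (auto simp: cnf_add_def)
  then show ?thesis
    using assms finite_subset[of _ "insert k {j. f j \<noteq> 0}"] unfolding Field_omega_pow_omega by blast
qed

lemma less_cnf_add: "f \<in> cnfs \<Longrightarrow> (f, cnf_add f k) \<in> omega_pow_omega - Id"
  by (rule omega_pow_omega_lessI[where k = k]) (auto intro: cnf_add_Field, auto simp: cnf_add_def)

text \<open>If \<open>k < p\<close>, the addition leaves the deciding coefficient at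
  \<open>p\<close> alone. If \<open>k = p\<close>, it raises that coefficient to at most
  \<open>g p\<close> and clears everything below.\<close>

lemma cnf_add_le:
  assumes "f \<in> cnfs" "g \<in> cnfs" "f p < g p" "\<forall>j>p. f j = g j" "k \<le> p"
  shows "(cnf_add f k, g) \<in> omega_pow_omega"
proof (cases "k = p")
  case True
  then show ?thesis
    using assms by (intro omega_pow_omega_leI[where k = k] cnf_add_Field) (auto simp: cnf_add_def)
next
  case False
  then have "cnf_add f k p < g p" "\<forall>j>p. cnf_add f k j = g j"
    using assms(3-5) by (auto simp: cnf_add_def)
  then have "(cnf_add f k, g) \<in> omega_pow_omega - Id"
    unfolding less_omega_pow_omega using assms(1,2) cnf_add_Field by blast
  then show ?thesis by simp
qed

text \<open>The coefficients of \<open>cnf_add f (Suc k)\<close> vanish up to \<open>k\<close>, so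
  the deciding position lies above \<open>k\<close>, where adding \<open>omega^k\<close> changes
  nothing.\<close>

lemma cnf_add_closed:
  assumes f: "f \<in> cnfs" and v: "(v, cnf_add f (Suc k)) \<in> omega_pow_omega - Id"
  shows "(cnf_add v k, cnf_add f (Suc k)) \<in> omega_pow_omega - Id"
proof -
  obtain p where vF: "v \<in> cnfs"
    and p: "v p < cnf_add f (Suc k) p" "\<forall>j>p. v j = cnf_add f (Suc k) j"
    using v unfolding less_omega_pow_omega by blast
  have "p > k" using p(1) by (auto simp: cnf_add_def split: if_splits)
  then have "cnf_add v k p < cnf_add f (Suc k) p" "\<forall>j>p. cnf_add v k j = cnf_add f (Suc k) j"
    using p by (auto simp: cnf_add_def[of v])
  then show ?thesis unfolding less_omega_pow_omega using cnf_add_Field f vF by blast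
qed

text \<open>The largest difference \<open>p\<close> between \<open>f\<close> and \<open>g\<close>
  must exceed \<open>k\<close>, since otherwise repeated addition of \<open>omega^k\<close> would
  leave the segment below \<open>g\<close>.\<close>

lemma cnf_add_least:
  assumes fg: "(f, g) \<in> omega_pow_omega - Id"
    and closed: "\<And>v. (f, v) \<in> omega_pow_omega \<Longrightarrow> (v, g) \<in> omega_pow_omega - Id \<Longrightarrow>
      (cnf_add v k, g) \<in> omega_pow_omega - Id"
  shows "(cnf_add f (Suc k), g) \<in> omega_pow_omega"
proof -
  obtain p where F: "f \<in> cnfs" "g \<in> cnfs" and p: "f p < g p" "\<forall>j>p. f j = g j"
    using fg unfolding less_omega_pow_omega by blast
  have ff: "(f, f) \<in> omega_pow_omega" using F omega_pow_omega_refl by blast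
  have "p > k"
  proof (rule ccontr)
    assume pk: "\<not> p > k"
    show False
    proof (cases "p = k")
      \<comment> \<open>Now \<open>p < k\<close>, so \<open>f\<close> and \<open>g\<close> agree at
        \<open>k\<close>, and a single addition of \<open>omega^k\<close> to \<open>f\<close>
        already overshoots \<open>g\<close>.\<close>
      case False
      then have "g k < cnf_add f k k" "\<And>j. j > k \<Longrightarrow> g j = cnf_add f k j"
        using pk p by (auto simp: cnf_add_def)
      then have "(g, cnf_add f k) \<in> omega_pow_omega - Id"
        using F cnf_add_Field omega_pow_omega_lessI by blast
      then show False using closed[OF ff fg] omega_pow_omega_not_le by blast
    next
      case True
      \<comment> \<open>The coefficient at \<open>k\<close> is one short of that of
        \<open>g\<close>, which is positive because \<open>f k < g k\<close>. One addition of
        \<open>omega^k\<close> may still stay below \<open>g\<close> on account of lower terms of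
        \<open>g\<close>; the second overshoots.\<close>
      define v where "v = f(k := g k - 1)"
      have vF: "v \<in> cnfs" using F(1) cnfs_fun_upd by (simp add: v_def)
      then have vkF: "cnf_add v k \<in> cnfs" by (rule cnf_add_Field)
      have vk: "v k = g k - 1" "cnf_add v k k = g k" "cnf_add (cnf_add v k) k k = Suc (g k)"
        using p True by (auto simp: v_def cnf_add_def)
      have above: "v j = g j" "cnf_add v k j = g j" "cnf_add (cnf_add v k) k j = g j" if "j > k" for j
        using p True that by (auto simp: v_def cnf_add_def)
      have "(f, v) \<in> omega_pow_omega"
        using F vF p True by (intro omega_pow_omega_leI[where k = k]) (auto simp: v_def)
      moreover have "(v, g) \<in> omega_pow_omega - Id"
        using F vF p True vk above by (intro omega_pow_omega_lessI[where k = k]) auto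
      ultimately have 1: "(cnf_add v k, g) \<in> omega_pow_omega - Id" by (rule closed)
      have "(f, cnf_add v k) \<in> omega_pow_omega - Id"
        using F vkF p True vk above by (intro omega_pow_omega_lessI[where k = k]) auto
      then have "(cnf_add (cnf_add v k) k, g) \<in> omega_pow_omega - Id" using closed 1 by blast
      moreover have "(g, cnf_add (cnf_add v k) k) \<in> omega_pow_omega - Id"
        using F cnf_add_Field[OF vkF] vk above by (intro omega_pow_omega_lessI[where k = k]) auto
      ultimately show False using omega_pow_omega_not_le by blast
    qed
  qed
  then show ?thesis using cnf_add_le[OF F p] by simp
qed

lemma add_pow_cnf_addI:
  assumes "above_pow omega_pow_omega k f (cnf_add f k)"
    and least: "\<And>g. above_pow omega_pow_omega k f g \<Longrightarrow> (cnf_add f k, g) \<in> omega_pow_omega"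
  shows "add_pow omega_pow_omega k f (cnf_add f k)"
proof -
  have "antisym omega_pow_omega" using Well_order_omega_pow_omega
    by (auto simp: well_order_on_def linear_order_on_def partial_order_on_def)
  then show ?thesis unfolding add_pow_def using assms by (auto dest: antisymD)
qed

text \<open>This ties the order-theoretic addition to normal forms. For leastness,
  \<open>add_pow_unique\<close> and the induction hypothesis identify the abstract witness
  \<open>w\<close> with \<open>cnf_add v k\<close>.\<close>

lemma add_pow_cnf_add: "f \<in> cnfs \<Longrightarrow> add_pow omega_pow_omega k f (cnf_add f k)"
proof (induction k arbitrary: f)
  case 0
  show ?case
  proof (rule add_pow_cnf_addI)
    show "above_pow omega_pow_omega 0 f (cnf_add f 0)" using less_cnf_add[OF 0] by simp
    fix g assume "above_pow omega_pow_omega 0 f g"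
    then obtain p where "f p < g p" "\<forall>j>p. f j = g j" "g \<in> cnfs"
      using less_omega_pow_omega[of f g] by auto
    then show "(cnf_add f 0, g) \<in> omega_pow_omega" using cnf_add_le 0 by blast
  qed
next
  case (Suc k)
  show ?case
  proof (rule add_pow_cnf_addI)
    show "above_pow omega_pow_omega (Suc k) f (cnf_add f (Suc k))"
      unfolding above_pow_Suc
    proof (intro conjI allI impI)
      show "(f, cnf_add f (Suc k)) \<in> omega_pow_omega - Id" using less_cnf_add Suc.prems .
      fix v assume "(f, v) \<in> omega_pow_omega \<and> (v, cnf_add f (Suc k)) \<in> omega_pow_omega - Id"
      then have v: "(v, cnf_add f (Suc k)) \<in> omega_pow_omega - Id" by blast
      then have "v \<in> cnfs" by (auto simp: Field_def)
      then show "\<exists>w. (w, cnf_add f (Suc k)) \<in> omega_pow_omega - Id \<and> add_pow omega_pow_omega k v w"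
        using Suc.IH cnf_add_closed[OF Suc.prems v] by blast
    qed
    fix g assume g: "above_pow omega_pow_omega (Suc k) f g"
    show "(cnf_add f (Suc k), g) \<in> omega_pow_omega"
    proof (rule cnf_add_least)
      show "(f, g) \<in> omega_pow_omega - Id" using above_pow_less g .
      fix v assume v: "(f, v) \<in> omega_pow_omega" "(v, g) \<in> omega_pow_omega - Id"
      then obtain w where w: "(w, g) \<in> omega_pow_omega - Id" "add_pow omega_pow_omega k v w"
        using g unfolding above_pow_Suc by blast
      moreover have "v \<in> cnfs" using v by (auto simp: Field_def)
      ultimately have "w = cnf_add v k"
        using add_pow_unique[OF Well_order_omega_pow_omega _ Suc.IH] by blast
      then show "(cnf_add v k, g) \<in> omega_pow_omega - Id" using w by simp
    qed
  qed
qed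

lemma wf_omega_pow_omega: "wf (omega_pow_omega - Id)"
  using Well_order_omega_pow_omega unfolding well_order_on_def by blast

text \<open>Lowering the coefficient at the least exponent \<open>k\<close> that occurs in
  \<open>f\<close> gives a smaller \<open>g\<close> with \<open>cnf_add g k = f\<close>, as nothing
  below \<open>k\<close> is left to absorb.\<close>

lemma pow_sum_exists: "f \<in> cnfs \<Longrightarrow> \<exists>ks. pow_sum omega_pow_omega ks f"
proof (induction f rule: wf_induct_rule[OF wf_omega_pow_omega])
  case (1 f)
  show ?case
  proof (cases "\<exists>k. f k \<noteq> 0")
    case False
    then have "(g, f) \<notin> omega_pow_omega - Id" for g unfolding less_omega_pow_omega by simp
    then have "pow_sum omega_pow_omega [] f"
      using 1(2) unfolding pow_sum.simps by blast
    then show ?thesis by blast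
  next
    case True
    define k where "k = (LEAST k. f k \<noteq> 0)"
    have k: "f k \<noteq> 0" unfolding k_def using True by (rule LeastI_ex)
    have low: "f j = 0" if "j < k" for j using not_less_Least that unfolding k_def by blast
    define g where "g = f(k := f k - 1)"
    have gF: "g \<in> cnfs" unfolding g_def using 1(2) by (rule cnfs_fun_upd)
    have eq: "cnf_add g k = f" using k low by (auto simp: cnf_add_def g_def fun_eq_iff)
    obtain ks where "pow_sum omega_pow_omega ks g"
      using 1(1)[of g] less_cnf_add[OF gF, of k] gF unfolding eq by blast
    then have "pow_sum omega_pow_omega (k # ks) f"
      using add_pow_cnf_add[OF gF, of k] unfolding eq pow_sum.simps by blast
    then show ?thesis by blast
  qed
qed

section \<open>The formulas\<close>

abbreviation le_form :: "nat \<Rightarrow> nat \<Rightarrow> ('f, unit) fo_form" where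
  "le_form x y \<equiv> Rel () [Var x, Var y]"

abbreviation less_form :: "nat \<Rightarrow> nat \<Rightarrow> ('f, unit) fo_form" where
  "less_form x y \<equiv> Conj (le_form x y) (Neg (Eq (Var x) (Var y)))"

text \<open>The bound index \<open>Suc (x + y)\<close> differs from \<open>x\<close> and
  \<open>y\<close>, so no variable is captured.\<close>

abbreviation least_form ::
    "(nat \<Rightarrow> nat \<Rightarrow> ('f, unit) fo_form) \<Rightarrow> nat \<Rightarrow> nat \<Rightarrow> ('f, unit) fo_form" where
  "least_form \<phi> x y \<equiv> Conj (\<phi> x y)
     (Neg (Ex (Suc (x + y)) (Conj (less_form (Suc (x + y)) y) (\<phi> x (Suc (x + y))))))"

text \<open>A transcription of \<open>above_pow_Suc_ex\<close>, up to the order of conjuncts, with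
  \<open>v\<close> and \<open>w\<close> fresh for \<open>x\<close> and \<open>y\<close>.\<close>

primrec above_pow_form :: "nat \<Rightarrow> nat \<Rightarrow> nat \<Rightarrow> ('f, unit) fo_form" where
  "above_pow_form 0 = less_form"
| "above_pow_form (Suc k) = (\<lambda>x y. let v = Suc (x + y); w = Suc v in
     Conj (less_form x y) (Neg (Ex v (Conj (Conj (le_form x v) (less_form v y))
       (Neg (Ex w (Conj (less_form w y) (least_form (above_pow_form k) v w))))))))"

definition add_pow_form :: "nat \<Rightarrow> nat \<Rightarrow> nat \<Rightarrow> ('f, unit) fo_form" where
  "add_pow_form k = least_form (above_pow_form k)"

primrec pow_sum_form :: "nat list \<Rightarrow> nat \<Rightarrow> ('f, unit) fo_form" where
  "pow_sum_form [] x = Neg (Ex (Suc x) (less_form (Suc x) x))"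
| "pow_sum_form (k # ks) x =
     Ex (Suc x) (Conj (pow_sum_form ks (Suc x)) (add_pow_form k (Suc x) x))"

lemma wf_above_pow_form: "wf_form (tree_sig n) (above_pow_form k x y)"
  by (induction k arbitrary: x y) (auto simp: tree_sig_def Let_def)

lemma wf_pow_sum_form: "wf_form (tree_sig n) (pow_sum_form ks x)"
  by (induction ks arbitrary: x)
    (auto simp: wf_above_pow_form add_pow_form_def, auto simp: tree_sig_def)

lemma free_vars_above_pow_form: "free_vars (above_pow_form k x y) \<subseteq> {x, y}"
proof (induction k arbitrary: x y)
  case (Suc k)
  let ?v = "Suc (x + y)" and ?w = "Suc (Suc (x + y))"
  show ?case using Suc[of ?v ?w] Suc[of ?v "Suc (?v + ?w)"] by (auto simp: Let_def)
qed simp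

lemma free_vars_pow_sum_form: "free_vars (pow_sum_form ks x) \<subseteq> {x}"
proof (induction ks arbitrary: x)
  case (Cons k ks)
  then show ?case
    using free_vars_above_pow_form[of k "Suc x" x]
      free_vars_above_pow_form[of k "Suc x" "Suc (Suc x + x)"]
    by (fastforce simp: add_pow_form_def)
qed auto

section \<open>Satisfaction of the formulas in the tree\<close>

definition tree_order :: "nat \<Rightarrow> 'a rel \<Rightarrow> ('a \<rightharpoonup> nat) rel" where
  "tree_order n r = {(s, t). s \<in> tree_nodes n r \<and> t \<in> tree_nodes n r \<and> s \<subseteq>\<^sub>m t}"

lemma Field_tree_order: "Field (tree_order n r) = tree_nodes n r"
  by (auto simp: tree_order_def Field_def)

lemma sat_less_form:
  assumes "e x \<in> tree_nodes n r" "e y \<in> tree_nodes n r"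
  shows "sat (tree n r) e (less_form x y) \<longleftrightarrow> (e x, e y) \<in> tree_order n r - Id"
    and "sat (tree n r) e (le_form x y) \<longleftrightarrow> (e x, e y) \<in> tree_order n r"
  using assms by (auto simp: tree_def tree_order_def)

lemma sat_Ex_tree:
  "sat (tree n r) e (Ex x \<phi>) \<longleftrightarrow> (\<exists>a\<in>tree_nodes n r. sat (tree n r) (e(x := a)) \<phi>)"
  by (simp add: tree_def)

lemma sat_Ex_less:
  assumes "e y \<in> tree_nodes n r" "x \<noteq> y"
  shows "sat (tree n r) e (Ex x (Conj (less_form x y) \<phi>)) \<longleftrightarrow>
    (\<exists>a. (a, e y) \<in> tree_order n r - Id \<and> sat (tree n r) (e(x := a)) \<phi>)"
proof -
  have "sat (tree n r) (e(x := a)) (less_form x y) \<longleftrightarrow> (a, e y) \<in> tree_order n r - Id"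
    if "a \<in> tree_nodes n r" for a
    using sat_less_form(1)[of "e(x := a)" x n r y] assms that by simp
  moreover have "a \<in> tree_nodes n r" if "(a, e y) \<in> tree_order n r - Id" for a
    using that by (simp add: tree_order_def)
  ultimately show ?thesis unfolding sat_Ex_tree sat.simps(4) by blast
qed

text \<open>The hypothesis covers all environments and variables because \<open>\<phi>\<close> is
  evaluated both at \<open>y\<close> and at the fresh variable ranging below it.\<close>

lemma sat_least_form:
  assumes "\<And>e x y. e x \<in> tree_nodes n r \<Longrightarrow> e y \<in> tree_nodes n r \<Longrightarrow>
      sat (tree n r) e (\<phi> x y) \<longleftrightarrow> above_pow (tree_order n r) k (e x) (e y)"
    and xy: "e x \<in> tree_nodes n r" "e y \<in> tree_nodes n r"
  shows "sat (tree n r) e (least_form \<phi> x y) \<longleftrightarrow> add_pow (tree_order n r) k (e x) (e y)"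
proof -
  let ?z = "Suc (x + y)"
  have "sat (tree n r) (e(?z := a)) (\<phi> x ?z) \<longleftrightarrow> above_pow (tree_order n r) k (e x) a"
    if "(a, e y) \<in> tree_order n r - Id" for a
    using assms(1)[of "e(?z := a)" x ?z] xy that by (simp add: tree_order_def)
  then have "sat (tree n r) e (Ex ?z (Conj (less_form ?z y) (\<phi> x ?z))) \<longleftrightarrow>
      (\<exists>a. (a, e y) \<in> tree_order n r - Id \<and> above_pow (tree_order n r) k (e x) a)"
    by (subst sat_Ex_less) (use xy in auto)
  then show ?thesis unfolding add_pow_def sat.simps(3,4) using assms(1)[OF xy] by simp
qed

lemma sat_above_pow_form:
  assumes "e x \<in> tree_nodes n r" "e y \<in> tree_nodes n r"
  shows "sat (tree n r) e (above_pow_form k x y) \<longleftrightarrow> above_pow (tree_order n r) k (e x) (e y)"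
  using assms
proof (induction k arbitrary: e x y)
  case 0
  then show ?case using sat_less_form by simp
next
  case (Suc k)
  let ?O = "tree_order n r" and ?sat = "sat (tree n r)"
  let ?v = "Suc (x + y)" and ?w = "Suc (Suc (x + y))"
  let ?\<psi> = "Ex ?w (Conj (less_form ?w y) (least_form (above_pow_form k) ?v ?w))"
  have node: "a \<in> tree_nodes n r" if "(a, e y) \<in> ?O - Id" for a
    using that by (simp add: tree_order_def)
  have parts: "?sat (e(?v := v)) ?\<psi> \<longleftrightarrow> (\<exists>w. (w, e y) \<in> ?O - Id \<and> add_pow ?O k v w)"
    "?sat (e(?v := v)) (le_form x ?v) \<longleftrightarrow> (e x, v) \<in> ?O"
    "?sat (e(?v := v)) (less_form ?v y) \<longleftrightarrow> (v, e y) \<in> ?O - Id"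
    if v: "v \<in> tree_nodes n r" for v
  proof -
    \<comment> \<open>Naming the updated environment lets its values at \<open>x\<close>,
      \<open>y\<close> and \<open>?v\<close> be rewritten without unfolding the update.\<close>
    define e' where "e' = e(?v := v)"
    have e': "e' x = e x" "e' y = e y" "e' ?v = v" by (simp_all add: e'_def)
    have w: "?sat (e'(?w := w)) (least_form (above_pow_form k) ?v ?w) \<longleftrightarrow> add_pow ?O k v w"
      if "w \<in> tree_nodes n r" for w
    proof -
      define e'' where "e'' = e'(?w := w)"
      have e'': "e'' ?v = v" "e'' ?w = w" using e' by (simp_all add: e''_def)
      show ?thesis
        using sat_least_form[OF Suc.IH, of e'' ?v ?w] v that unfolding e'' e''_def[symmetric] by blast
    qed
    have "?sat e' ?\<psi> \<longleftrightarrow> (\<exists>w. (w, e' y) \<in> ?O - Id \<and>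
        ?sat (e'(?w := w)) (least_form (above_pow_form k) ?v ?w))"
      using Suc.prems(2) e'(2) by (intro sat_Ex_less) simp_all
    then show "?sat (e(?v := v)) ?\<psi> \<longleftrightarrow> (\<exists>w. (w, e y) \<in> ?O - Id \<and> add_pow ?O k v w)"
      unfolding e' e'_def[symmetric] using w node by blast
    show "?sat (e(?v := v)) (le_form x ?v) \<longleftrightarrow> (e x, v) \<in> ?O"
      using sat_less_form(2)[of e' x n r ?v] Suc.prems v unfolding e' e'_def[symmetric] by blast
    show "?sat (e(?v := v)) (less_form ?v y) \<longleftrightarrow> (v, e y) \<in> ?O - Id"
      using sat_less_form(1)[of e' ?v n r y] Suc.prems v unfolding e' e'_def[symmetric] by blast
  qed
  have "?sat e (above_pow_form (Suc k) x y) \<longleftrightarrow> ?sat e (less_form x y) \<and>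
      \<not> (\<exists>v\<in>tree_nodes n r. (?sat (e(?v := v)) (le_form x ?v) \<and> ?sat (e(?v := v)) (less_form ?v y)) \<and>
        \<not> ?sat (e(?v := v)) ?\<psi>)"
    unfolding above_pow_form.simps Let_def sat.simps(3) sat.simps(4) sat_Ex_tree ..
  also have "\<dots> \<longleftrightarrow> (e x, e y) \<in> ?O - Id \<and> \<not> (\<exists>v\<in>tree_nodes n r. ((e x, v) \<in> ?O \<and>
      (v, e y) \<in> ?O - Id) \<and> \<not> (\<exists>w. (w, e y) \<in> ?O - Id \<and> add_pow ?O k v w))"
    unfolding sat_less_form(1)[OF Suc.prems]
    by (intro arg_cong2[where f = "(\<and>)"] arg_cong[where f = Not] bex_cong refl) (erule parts)+
  also have "\<dots> \<longleftrightarrow> above_pow ?O (Suc k) (e x) (e y)"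
    unfolding above_pow_Suc_ex using node by blast
  finally show ?case .
qed

lemma sat_pow_sum_form:
  assumes "e x \<in> tree_nodes n r"
  shows "sat (tree n r) e (pow_sum_form ks x) \<longleftrightarrow> pow_sum (tree_order n r) ks (e x)"
  using assms
proof (induction ks arbitrary: e x)
  case Nil
  have "sat (tree n r) e (Ex (Suc x) (less_form (Suc x) x)) \<longleftrightarrow>
      (\<exists>a\<in>tree_nodes n r. (a, e x) \<in> tree_order n r - Id)"
    unfolding sat_Ex_tree using sat_less_form(1)[of "e(Suc x := _)" "Suc x" n r x] Nil by auto
  then show ?case using Nil
    by (auto simp: Field_tree_order) (auto simp: tree_order_def)
next
  case (Cons k ks)
  let ?e = "\<lambda>a. e(Suc x := a)"
  have "sat (tree n r) (?e a) (pow_sum_form ks (Suc x)) \<longleftrightarrow> pow_sum (tree_order n r) ks a"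
    if "a \<in> tree_nodes n r" for a
    using that Cons.IH[of "?e a" "Suc x"] by (metis fun_upd_same)
  moreover have "sat (tree n r) (?e a) (add_pow_form k (Suc x) x) \<longleftrightarrow>
      add_pow (tree_order n r) k a (e x)" if "a \<in> tree_nodes n r" for a
  proof -
    have "?e a (Suc x) = a" "?e a x = e x" by simp_all
    then show ?thesis
      using sat_least_form[OF sat_above_pow_form, of n r "?e a" "Suc x" x k] that Cons.prems
      unfolding add_pow_form_def by metis
  qed
  ultimately show ?case
    unfolding pow_sum_form.simps sat_Ex_tree sat.simps(4) pow_sum.simps
    using pow_sum_Field[of "tree_order n r"] unfolding Field_tree_order by blast
qed

section \<open>Lengths of nodes\<close>

text \<open>This turns comparison of lengths into inclusion of domains. If \<open>a\<close> were not
  below \<open>b\<close>, then \<open>b\<close> would lie in \<open>underS r a\<close>, but it never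
  lies in \<open>underS r b\<close>.\<close>

lemma underS_subset_iff:
  assumes "Well_order r" "a \<in> Field r" "b \<in> Field r"
  shows "underS r a \<subseteq> underS r b \<longleftrightarrow> (a, b) \<in> r"
proof
  have ord: "trans r" "antisym r" "refl_on (Field r) r" "total_on (Field r) r"
    using assms(1) by (auto simp: well_order_on_def linear_order_on_def
        partial_order_on_def preorder_on_def)
  show "underS r a \<subseteq> underS r b" if "(a, b) \<in> r"
    using that ord(1,2) unfolding underS_def by (blast dest: transD antisymD)
  show "(a, b) \<in> r" if sub: "underS r a \<subseteq> underS r b"
  proof (rule ccontr)
    assume "(a, b) \<notin> r"
    moreover from this have "a \<noteq> b" using assms(2) ord(3) by (auto simp: refl_on_def)
    ultimately have "b \<in> underS r a"
      using assms(2,3) ord(3,4) by (auto simp: refl_on_def total_on_def underS_def)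
    then show False using sub by (auto simp: underS_def)
  qed
qed

lemma tree_length:
  assumes "Well_order r" "s \<in> tree_nodes n r"
  shows "tree_length r s \<in> Field r" "dom s = underS r (tree_length r s)"
  using assms tree_length_eq[OF assms(1)] by (auto simp: tree_nodes_def)

text \<open>The nodes below a node are its restrictions to initial segments, exactly one for each
  length up to its own. Incompatible nodes can have comparable lengths, so order is reflected only
  below a common extension.\<close>

lemma tree_length_down_morphism:
  assumes r: "Well_order r"
  shows "down_morphism (tree_order n r) r (tree_length r)"
proof
  have nodes: "s \<in> tree_nodes n r" "t \<in> tree_nodes n r" "s \<subseteq>\<^sub>m t"
    if "(s, t) \<in> tree_order n r" for s t
    using that by (auto simp: tree_order_def)
  have length_le: "(tree_length r s, tree_length r t) \<in> r \<longleftrightarrow> dom s \<subseteq> dom t"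
    if "s \<in> tree_nodes n r" "t \<in> tree_nodes n r" for s t
    using underS_subset_iff[OF r] tree_length[OF r that(1)] tree_length[OF r that(2)] by simp
  show "antisym r" using r
    by (auto simp: well_order_on_def linear_order_on_def partial_order_on_def)
  show "Partial_order (tree_order n r)"
    unfolding partial_order_on_def preorder_on_def Field_tree_order
    by (auto simp: tree_order_def refl_on_def trans_def antisym_def
        intro: map_le_trans map_le_antisym)
  show "tree_length r s \<in> Field r" if "s \<in> Field (tree_order n r)" for s
    using that tree_length(1)[OF r] by (simp add: Field_tree_order)
  show "(tree_length r s, tree_length r t) \<in> r" if "(s, t) \<in> tree_order n r" for s t
    using length_le nodes[OF that] map_le_implies_dom_le by blast
  show "\<exists>s. (s, t) \<in> tree_order n r \<and> tree_length r s = b"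
    if "t \<in> Field (tree_order n r)" "(b, tree_length r t) \<in> r" for t b
  proof -
    have t: "t \<in> tree_nodes n r" using that by (simp add: Field_tree_order)
    have b: "b \<in> Field r" using that(2) by (auto simp: Field_def)
    \<comment> \<open>The node of length \<open>b\<close> below \<open>t\<close> is obtained by
      cutting \<open>t\<close> off at \<open>b\<close>.\<close>
    let ?s = "t |` underS r b"
    have "underS r b \<subseteq> dom t"
      using underS_subset_iff[OF r b] tree_length[OF r t] that(2) by simp
    then have dom: "dom ?s = underS r b" by auto
    have "ran ?s \<subseteq> ran t" by (auto simp: ran_def restrict_map_def split: if_splits)
    then have "?s \<in> tree_nodes n r" using t b dom unfolding tree_nodes_def by blast
    moreover have "?s \<subseteq>\<^sub>m t" by (auto simp: map_le_def)
    ultimately show ?thesis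
      using t tree_length_eq[OF r b dom] by (auto simp: tree_order_def)
  qed
  show "(s, t) \<in> tree_order n r"
    if "(s, u) \<in> tree_order n r" "(t, u) \<in> tree_order n r" "(tree_length r s, tree_length r t) \<in> r"
    for s t u
  proof -
    have st: "s \<in> tree_nodes n r" "t \<in> tree_nodes n r" "s \<subseteq>\<^sub>m u" "t \<subseteq>\<^sub>m u"
      using that(1,2)[THEN nodes(1)] that(1,2)[THEN nodes(3)] .
    have "dom s \<subseteq> dom t" using length_le[OF st(1,2)] that(3) by blast
    \<comment> \<open>Both nodes are parts of \<open>u\<close>, so they agree wherever both are
      defined.\<close>
    have "s x = t x" if "x \<in> dom s" for x
    proof -
      have "x \<in> dom t" using that \<open>dom s \<subseteq> dom t\<close> by blast
      then show ?thesis using that st(3,4) by (simp add: map_le_def)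
    qed
    then show ?thesis using st(1,2) by (simp add: tree_order_def map_le_def)
  qed
qed

text \<open>The witness is the constant sequence of entry 0, which is allowed as \<open>n\<close> is
  positive.\<close>

lemma tree_length_surj:
  assumes "Well_order r" "n \<ge> 1" "a \<in> Field r"
  shows "\<exists>s\<in>tree_nodes n r. tree_length r s = a"
proof -
  let ?s = "\<lambda>x. if x \<in> underS r a then Some 0 else None"
  have dom: "dom ?s = underS r a" by (auto simp: dom_def)
  moreover have "ran ?s \<subseteq> {..<n}" using assms(2) by (auto simp: ran_def split: if_splits)
  ultimately have "?s \<in> tree_nodes n r" using assms(3) unfolding tree_nodes_def by blast
  then show ?thesis using tree_length_eq[OF assms(1,3) dom] by blast
qed

lemma models_pow_sum_form:
  assumes r: "nonzero_limit r" and n: "n \<ge> 1"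
  shows "models (tree n r) (Ex 0 (pow_sum_form ks 0)) \<longleftrightarrow> (\<exists>a\<in>Field r. pow_sum r ks a)"
proof -
  have wo: "Well_order r" and ne: "tree_nodes n r \<noteq> {}"
    using r is_struct_tree[OF r, of n] by (auto simp: nonzero_limit_def is_struct_def tree_def)
  interpret down_morphism "tree_order n r" r "tree_length r"
    by (rule tree_length_down_morphism[OF wo])
  have "(\<exists>s\<in>tree_nodes n r. pow_sum (tree_order n r) ks s) \<longleftrightarrow> (\<exists>a\<in>Field r. pow_sum r ks a)"
    using pow_sum_iff[unfolded Field_tree_order] tree_length(1)[OF wo] tree_length_surj[OF wo n]
    by metis
  moreover have "sat (tree n r) e (Ex 0 (pow_sum_form ks 0)) \<longleftrightarrow>
      (\<exists>s\<in>tree_nodes n r. pow_sum (tree_order n r) ks s)" for e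
    unfolding sat_Ex_tree by (simp add: sat_pow_sum_form)
  \<comment> \<open>Since \<open>models\<close> quantifies over environments, it would hold
    vacuously without one; the empty sequence of assumptions is excluded by a nonempty
    universe.\<close>
  moreover have "\<exists>e :: nat \<Rightarrow> _. range e \<subseteq> tree_nodes n r"
    using ne by (auto intro!: exI[of _ "\<lambda>_. SOME s. s \<in> tree_nodes n r"] simp: some_in_eq)
  ultimately show ?thesis unfolding models_def by (auto simp: tree_def)
qed

section \<open>Isomorphic structures\<close>

text \<open>Interpretations are total on their types, so agreement is required only for arguments in
  the universe; \<open>fn_closed\<close> keeps term values there.\<close>

locale fo_iso =
  fixes L :: "('f, 'p) fo_sig" and M :: "('a, 'f, 'p) fo_struct" and N :: "('b, 'f, 'p) fo_struct"
    and H :: "'a \<Rightarrow> 'b"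
  assumes bij: "bij_betw H (universe M) (universe N)"
    and fn_closed: "fn_arity L f = Some (length xs) \<Longrightarrow> set xs \<subseteq> universe M \<Longrightarrow>
      fn_int M f xs \<in> universe M"
    and fn: "fn_arity L f = Some (length xs) \<Longrightarrow> set xs \<subseteq> universe M \<Longrightarrow>
      H (fn_int M f xs) = fn_int N f (map H xs)"
    and rel: "rel_arity L p = Some (length xs) \<Longrightarrow> set xs \<subseteq> universe M \<Longrightarrow>
      rel_int M p xs \<longleftrightarrow> rel_int N p (map H xs)"
begin

lemma term_val_iso:
  assumes "range e \<subseteq> universe M" "wf_term L t"
  shows "term_val M e t \<in> universe M \<and> term_val N (H \<circ> e) t = H (term_val M e t)"
  using assms(2)
proof (induction t)
  case (Var x)
  then show ?case using assms(1) by auto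
next
  case (Fn f ts)
  let ?xs = "map (term_val M e) ts"
  have "set ?xs \<subseteq> universe M" and args: "map (term_val N (H \<circ> e)) ts = map H ?xs"
    using Fn by (auto simp: comp_def)
  then show ?case
    using Fn.prems fn[of f ?xs] fn_closed[of f ?xs] unfolding term_val.simps args by simp
qed

text \<open>Equations use the injectivity of \<open>H\<close>, quantifiers its surjectivity onto the
  universe of \<open>N\<close>.\<close>

lemma sat_iso:
  assumes "range e \<subseteq> universe M" "wf_form L \<phi>"
  shows "sat N (H \<circ> e) \<phi> \<longleftrightarrow> sat M e \<phi>"
  using assms
proof (induction \<phi> arbitrary: e)
  case (Eq t u)
  then show ?case using term_val_iso bij
    by (metis bij_betw_inv_into_left sat.simps(1) wf_form.simps(1))
next
  case (Rel p ts)
  let ?xs = "map (term_val M e) ts"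
  have "set ?xs \<subseteq> universe M" and args: "map (term_val N (H \<circ> e)) ts = map H ?xs"
    using Rel term_val_iso by auto
  then show ?case using Rel.prems rel[of p ?xs] unfolding sat.simps args by simp
next
  case (Ex x \<phi>)
  have eq: "sat N ((H \<circ> e)(x := H a)) \<phi> \<longleftrightarrow> sat M (e(x := a)) \<phi>" if a: "a \<in> universe M" for a
  proof -
    have "range (e(x := a)) \<subseteq> universe M" using Ex.prems(1) a by auto
    then have "sat N (H \<circ> e(x := a)) \<phi> \<longleftrightarrow> sat M (e(x := a)) \<phi>"
      using Ex.IH[of "e(x := a)"] Ex.prems(2) unfolding wf_form.simps by blast
    then show ?thesis by (simp only: fun_upd_comp)
  qed
  have "universe N = H ` universe M" using bij by (simp add: bij_betw_def)
  then show ?case by (simp only: sat.simps bex_simps eq cong: bex_cong)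
qed auto

lemma models_iso:
  assumes "wf_form L \<phi>"
  shows "models M \<phi> \<longleftrightarrow> models N \<phi>"
proof
  assume N: "models N \<phi>"
  show "models M \<phi>" unfolding models_def
  proof (intro allI impI)
    fix e :: "nat \<Rightarrow> 'a" assume e: "range e \<subseteq> universe M"
    then have "range (H \<circ> e) \<subseteq> universe N" using bij by (auto simp: bij_betw_def)
    then show "sat M e \<phi>" using N sat_iso[OF e assms] by (auto simp: models_def)
  qed
next
  assume M: "models M \<phi>"
  show "models N \<phi>" unfolding models_def
  proof (intro allI impI)
    fix e :: "nat \<Rightarrow> 'b" assume e: "range e \<subseteq> universe N"
    let ?e = "inv_into (universe M) H \<circ> e"
    have "range ?e \<subseteq> universe M" "H \<circ> ?e = e"
      using e bij by (auto simp: bij_betw_def inv_into_into f_inv_into_f image_subset_iff fun_eq_iff)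
    then show "sat N e \<phi>" using M sat_iso[of ?e \<phi>] assms by (auto simp: models_def)
  qed
qed

end

section \<open>Transport of nodes along an isomorphism of well-orders\<close>

definition pull_node :: "'a rel \<Rightarrow> ('a \<Rightarrow> 'b) \<Rightarrow> ('b \<rightharpoonup> nat) \<Rightarrow> ('a \<rightharpoonup> nat)" where
  "pull_node r f t = (\<lambda>x. if x \<in> Field r then t (f x) else None)"

text \<open>The preimage under \<open>f\<close> of the domain of \<open>t\<close> is the initial
  segment at the point that \<open>f\<close> sends to the length of \<open>t\<close>.\<close>

lemma pull_node:
  assumes f: "iso r r' f" and r: "Well_order r" and r': "Well_order r'"
    and t: "t \<in> tree_nodes n r'"
  shows "pull_node r f t \<in> tree_nodes n r" "f (tree_length r (pull_node r f t)) = tree_length r' t"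
proof -
  have bij: "bij_betw f (Field r) (Field r')"
    and ord: "\<And>x y. x \<in> Field r \<Longrightarrow> y \<in> Field r \<Longrightarrow> (x, y) \<in> r \<longleftrightarrow> (f x, f y) \<in> r'"
    using f by (auto simp: iso_iff2)
  obtain a where a: "a \<in> Field r" "f a = tree_length r' t"
    using tree_length(1)[OF r' t] bij by (metis bij_betw_imp_surj_on imageE)
  have "dom (pull_node r f t) = {x \<in> Field r. f x \<in> underS r' (f a)}"
    unfolding a(2) tree_length(2)[OF r' t, symmetric]
    by (auto simp: pull_node_def dom_def split: if_splits)
  also have "\<dots> = underS r a"
  proof -
    have "x \<in> underS r a \<longleftrightarrow> x \<in> Field r \<and> f x \<in> underS r' (f a)" for x
    proof (cases "x \<in> Field r")
      case True
      then show ?thesis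
        using ord[OF True a(1)] inj_on_eq_iff[OF bij_betw_imp_inj_on[OF bij] True a(1)]
        by (simp add: underS_def)
    next
      case False
      then show ?thesis by (auto simp: underS_def intro: FieldI1)
    qed
    then show ?thesis by blast
  qed
  finally have dom: "dom (pull_node r f t) = underS r a" .
  have "ran (pull_node r f t) \<subseteq> ran t" by (auto simp: ran_def pull_node_def split: if_splits)
  then show "pull_node r f t \<in> tree_nodes n r" using dom a(1) t unfolding tree_nodes_def by blast
  show "f (tree_length r (pull_node r f t)) = tree_length r' t"
    using tree_length_eq[OF r a(1) dom] a(2) by simp
qed

lemma pull_node_inverse:
  assumes "bij_betw f (Field r) (Field r')" "dom t \<subseteq> Field r'"
  shows "pull_node r' (inv_into (Field r) f) (pull_node r f t) = t"
proof
  fix y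
  have "t y = None" if "y \<notin> Field r'" using that assms(2) by (meson domIff subsetD)
  then show "pull_node r' (inv_into (Field r) f) (pull_node r f t) y = t y"
    using assms(1) bij_betw_inv_into_right[OF assms(1), of y] bij_betwE[OF bij_betw_inv_into[OF assms(1)]]
    by (cases "y \<in> Field r'") (auto simp: pull_node_def intro: sym)
qed

text \<open>Pulling back reverses direction: an isomorphism from \<open>r\<close> to
  \<open>r'\<close> sends the tree over \<open>r'\<close> to the tree over \<open>r\<close>.\<close>

lemma fo_iso_pull_node:
  assumes f: "iso r r' f" and r: "nonzero_limit r" and r': "nonzero_limit r'"
  shows "fo_iso (tree_sig n) (tree n r') (tree n r) (pull_node r f)"
proof
  have wo: "Well_order r" "Well_order r'" using r r' by (auto simp: nonzero_limit_def)
  let ?g = "inv_into (Field r) f"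
  have bij: "bij_betw f (Field r) (Field r')" using f by (simp add: iso_def)
  have "bij_betw ?g (Field r') (Field r)" using bij by (rule bij_betw_inv_into)
  then have g: "iso r' r ?g"
    using f bij bij_betw_inv_into_right[OF bij] bij_betwE unfolding iso_iff2 by fastforce
  have nodes_dom: "dom s \<subseteq> Field R" if "s \<in> tree_nodes n R" for s and R :: "'c rel"
    using that by (auto simp: tree_nodes_def underS_def Field_def)
  have inv1: "pull_node r' ?g (pull_node r f t) = t" if "t \<in> tree_nodes n r'" for t
    using pull_node_inverse[OF bij] nodes_dom that by blast
  have inv2: "pull_node r f (pull_node r' ?g s) = s" if s: "s \<in> tree_nodes n r" for s
  proof
    fix x
    have "s x = None" if "x \<notin> Field r" using that nodes_dom[OF s] by (meson domIff subsetD)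
    then show "pull_node r f (pull_node r' ?g s) x = s x"
      using bij
      by (cases "x \<in> Field r") (auto simp: pull_node_def bij_betw_def inv_into_f_f)
  qed
  show "bij_betw (pull_node r f) (universe (tree n r')) (universe (tree n r))"
    unfolding tree_def fo_struct.simps
    by (rule bij_betw_byWitness[where f' = "pull_node r' ?g"])
      (use inv1 inv2 pull_node(1)[OF f wo] pull_node(1)[OF g wo(2,1)] in auto)
  have le: "pull_node r f s \<subseteq>\<^sub>m pull_node r f t \<longleftrightarrow> s \<subseteq>\<^sub>m t"
    if "s \<in> tree_nodes n r'" "t \<in> tree_nodes n r'" for s t
  proof -
    \<comment> \<open>Stated for arbitrary \<open>R\<close> and \<open>h\<close>, so that it also
      applies to the inverse pullback, which yields the reflection of inclusion.\<close>
    have mono: "pull_node R h s \<subseteq>\<^sub>m pull_node R h t" if "s \<subseteq>\<^sub>m t"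
      for R :: "'d rel" and h :: "'d \<Rightarrow> 'e" and s t
      using that by (auto simp: pull_node_def map_le_def dom_def)
    show ?thesis using mono[of s t r f] mono[of "pull_node r f s" "pull_node r f t" r' ?g]
      inv1 that by auto
  qed
  show "rel_int (tree n r') p xs \<longleftrightarrow> rel_int (tree n r) p (map (pull_node r f) xs)"
    if "rel_arity (tree_sig n) p = Some (length xs)" "set xs \<subseteq> universe (tree n r')" for p xs
  proof -
    have "length xs = 2" using that(1) by (simp add: tree_sig_def)
    then obtain s t where "xs = [s, t]" by (auto simp: length_Suc_conv numeral_2_eq_2)
    then show ?thesis using that(2) le by (simp add: tree_def)
  qed
  fix i and xs :: "('b \<rightharpoonup> nat) list"
  assume i: "fn_arity (tree_sig n) i = Some (length xs)" and xs: "set xs \<subseteq> universe (tree n r')"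
  show "fn_int (tree n r') i xs \<in> universe (tree n r')"
    using is_struct_tree[OF r', of n] i xs unfolding is_struct_def by blast
  have "length xs = 1" using i by (simp add: tree_sig_def split: if_splits)
  then obtain t where t: "xs = [t]" by (auto simp: length_Suc_conv)
  then have tn: "t \<in> tree_nodes n r'" using xs by (simp add: tree_def)
  let ?a = "tree_length r (pull_node r f t)"
  have "?a \<in> Field r" using tree_length(1)[OF wo(1) pull_node(1)[OF f wo tn]] .
  \<comment> \<open>Injectivity of \<open>f\<close> on \<open>Field r\<close> turns the update at
    \<open>f ?a\<close>, which is the length of \<open>t\<close>, into an update at
    \<open>?a\<close> alone.\<close>
  then have "pull_node r f (t(f ?a \<mapsto> i)) = (pull_node r f t)(?a \<mapsto> i)"
    using bij by (auto simp: pull_node_def fun_eq_iff bij_betw_def inj_on_def)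
  then show "pull_node r f (fn_int (tree n r') i xs) = fn_int (tree n r) i (map (pull_node r f) xs)"
    using pull_node(2)[OF f wo tn] t by (simp add: tree_def tree_succ_def)
qed

section \<open>Elementary equivalence\<close>

lemma elem_equiv_pow_sum:
  assumes "n \<ge> 1" "nonzero_limit r" "nonzero_limit r'" "elem_equiv (tree_sig n) (tree n r) (tree n r')"
  shows "(\<exists>a\<in>Field r. pow_sum r ks a) \<longleftrightarrow> (\<exists>a\<in>Field r'. pow_sum r' ks a)"
proof -
  have "sentence (tree_sig n) (Ex 0 (pow_sum_form ks 0))"
    using wf_pow_sum_form free_vars_pow_sum_form[of ks 0] by (auto simp: sentence_def)
  then show ?thesis
    using assms models_pow_sum_form unfolding elem_equiv_def by metis
qed

text \<open>By absoluteness and uniqueness of sums, the image depends only on which lists of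
  exponents \<open>r\<close> realises.\<close>

lemma embed_image_pow_sum:
  assumes "Well_order r" "embed r omega_pow_omega h"
  shows "h ` Field r = {f \<in> cnfs. \<exists>ks. pow_sum omega_pow_omega ks f \<and> (\<exists>a\<in>Field r. pow_sum r ks a)}"
proof -
  interpret down_morphism r omega_pow_omega h
    by (rule embed_down_morphism[OF assms(1) Well_order_omega_pow_omega assms(2)])
  show ?thesis
  proof (intro equalityI subsetI)
    fix f assume "f \<in> h ` Field r"
    then obtain a where a: "a \<in> Field r" "f = h a" by blast
    then show "f \<in> {f \<in> cnfs. \<exists>ks. pow_sum omega_pow_omega ks f \<and> (\<exists>a\<in>Field r. pow_sum r ks a)}"
      using Field pow_sum_exists pow_sum_iff by blast
  next
    fix f assume "f \<in> {f \<in> cnfs. \<exists>ks. pow_sum omega_pow_omega ks f \<and> (\<exists>a\<in>Field r. pow_sum r ks a)}"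
    then show "f \<in> h ` Field r"
      using pow_sum_iff pow_sum_unique[OF Well_order_omega_pow_omega] by blast
  qed
qed

theorem theorem19:
  fixes n :: nat and \<theta> :: "'a rel" and \<alpha> :: "'b rel"
  assumes "n \<ge> 2"
    and "nonzero_limit \<theta>" and "(\<theta>, omega_pow_omega) \<in> ordLess"
    and "nonzero_limit \<alpha>"
  shows "elem_equiv (tree_sig n) (tree n \<alpha>) (tree n \<theta>) \<longleftrightarrow> (\<alpha>, \<theta>) \<in> ordIso"
proof
  let ?W = "omega_pow_omega"
  have W: "Well_order ?W" by (rule Well_order_omega_pow_omega)
  have wo: "Well_order \<theta>" "Well_order \<alpha>" using assms by (auto simp: nonzero_limit_def)
  {
    assume "elem_equiv (tree_sig n) (tree n \<alpha>) (tree n \<theta>)"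
    then have eq: "(\<exists>a\<in>Field \<alpha>. pow_sum \<alpha> ks a) \<longleftrightarrow> (\<exists>a\<in>Field \<theta>. pow_sum \<theta> ks a)" for ks
      using elem_equiv_pow_sum assms(1,2,4) by (metis Suc_1 Suc_leD One_nat_def)
    obtain g where g: "embed \<theta> ?W g" "\<not> bij_betw g (Field \<theta>) (Field ?W)"
      using assms(3) by (auto simp: ordLess_def embedS_def)
    \<comment> \<open>If \<open>omega_pow_omega\<close> embedded into \<open>\<alpha>\<close>, then
      \<open>\<alpha>\<close>, and with it \<open>\<theta>\<close>, would realise every sum;
      \<open>g\<close> would be onto, against \<open>\<theta>\<close> being smaller.\<close>
    have "\<not> embed ?W \<alpha> h" for h
    proof
      assume h: "embed ?W \<alpha> h"
      interpret down_morphism ?W \<alpha> h by (rule embed_down_morphism[OF W wo(2) h])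
      have "\<exists>a\<in>Field \<theta>. pow_sum \<theta> ks a" if "f \<in> cnfs" "pow_sum ?W ks f" for f ks
        using that pow_sum_iff Field eq by blast
      then have "g ` Field \<theta> = cnfs"
        unfolding embed_image_pow_sum[OF wo(1) g(1)] using pow_sum_exists by blast
      then show False
        using g embed_inj_on[OF wo(1) g(1)] by (simp add: bij_betw_def)
    qed
    then obtain h where h: "embed \<alpha> ?W h"
      using ordLess_or_ordLeq[OF wo(2) W] by (auto simp: ordLess_def ordLeq_def embedS_def)
    \<comment> \<open>Both images are determined by the realised sums, and \<open>eq\<close> says
      that these are the same.\<close>
    have "h ` Field \<alpha> = g ` Field \<theta>"
      unfolding embed_image_pow_sum[OF wo(2) h] embed_image_pow_sum[OF wo(1) g(1)] eq ..
    then have "(\<alpha>, Restr ?W (h ` Field \<alpha>)) \<in> ordIso" "(\<theta>, Restr ?W (h ` Field \<alpha>)) \<in> ordIso"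
      using embed_implies_iso_Restr[OF W wo(2) h] embed_implies_iso_Restr[OF W wo(1) g(1)]
        wo Well_order_Restr[OF W] by (auto simp: ordIso_def)
    then show "(\<alpha>, \<theta>) \<in> ordIso" using ordIso_symmetric ordIso_transitive by blast
  next
    assume "(\<alpha>, \<theta>) \<in> ordIso"
    \<comment> \<open>The isomorphism is taken from \<open>\<theta>\<close> to
      \<open>\<alpha>\<close> because pulling back reverses its direction.\<close>
    then obtain f where "iso \<theta> \<alpha> f" using ordIso_symmetric by (fastforce simp: ordIso_def)
    then interpret fo_iso "tree_sig n" "tree n \<alpha>" "tree n \<theta>" "pull_node \<theta> f"
      using fo_iso_pull_node assms by blast
    show "elem_equiv (tree_sig n) (tree n \<alpha>) (tree n \<theta>)"
      using models_iso by (simp add: elem_equiv_def sentence_def)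
  }
qed

end
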